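(* The space $\mathcal{M}_{\mathbb{N}:k}$ of partition operators is in one-to-one correspondence with the set $\Sigma$ of strongly Lipschitz continuous maps on $\mathcal{L}_{\mathbb{N}:k}$.
   Context: Fix $k\in\mathbb{N}$. Write $[n]=\{1,\dots,n\}$. For $A\subseteq\mathbb{N}$, a $k$-partition of $A$ is a vector $\lambda=(\lambda_1,\dots,\lambda_k)$ of pairwise disjoint (possibly empty) subsets of $A$ with union $A$; $\mathcal{L}_{A:k}$ is the set of these. The restriction to $[n]$ is $\lambda_{|[n]}=(\lambda_1\cap[n],\dots,\lambda_k\cap[n])$. $\mathcal{L}_{\mathbb{N}:k}$ carries the ultrametric $d(\lambda,\lambda')=2^{-\mathbf{n}(\lambda,\lambda')}$, $\mathbf{n}(\lambda,\lambda')=\max\{n:\lambda_{|[n]}=\lambda'_{|[n]}\}$ (equal to $0$ if the restrictions to $[1]$ differ, and $\infty$ if $\lambda=\lambda'$, with $2^{-\infty}=0$). $\mathrm{Lip}(\mathcal{L}_{\mathbb{N}:k})$ is the set of maps $F:\mathcal{L}_{\mathbb{N}:k}\to\mathcal{L}_{\mathbb{N}:k}$ with $d(F(\lambda),F(\lambda'))\le d(\lambda,\lambda')$ for all $\lambda,\lambda'$; its restriction to $\mathcal{L}_{[n]:k}$ is $F_{[n]}(\lambda)=F(\lambda^* )_{|[n]}$ for any $\lambda^*\in\mathcal{L}_{\mathbb{N}:k}$ with $\lambda^*_{|[n]}=\lambda$. The overlap of $\lambda,\lambda'\in\mathcal{L}_{A:k}$ is $\lambda\cap\lambda'=\bigcup_{i=1}^k(\lambda_i\cap\lambda_i')$.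 $\Sigma=\bigcap_{n\in\mathbb{N}}\Sigma_n$, where $\Sigma_n=\{F\in\mathrm{Lip}(\mathcal{L}_{\mathbb{N}:k}): F_{[n]}(\lambda)\cap F_{[n]}(\lambda')\supseteq\lambda\cap\lambda'\text{ for all }\lambda,\lambda'\in\mathcal{L}_{[n]:k}\}$; thus $\Sigma$ is the set of $F\in\mathrm{Lip}(\mathcal{L}_{\mathbb{N}:k})$ with $F(\lambda)\cap F(\lambda')\supseteq\lambda\cap\lambda'$ for all $\lambda,\lambda'\in\mathcal{L}_{\mathbb{N}:k}$ (strongly Lipschitz continuous maps). A partition operator over $\mathbb{N}$ is a $k\times k$ matrix $M=(M_{ij})$ of subsets of $\mathbb{N}$ each of whose columns $M^j=(M_{1j},\dots,M_{kj})$ belongs to $\mathcal{L}_{\mathbb{N}:k}$; $\mathcal{M}_{\mathbb{N}:k}$ is the set of these. A partition operator $M$ acts on $\lambda\in\mathcal{L}_{\mathbb{N}:k}$ by $(M\lambda)_i=\bigcup_{j=1}^k(M_{ij}\cap\lambda_j)$, $i=1,\dots,k$. *)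

theory Defs
  imports Complex_Main "HOL-Library.FuncSet" "HOL-Library.Disjoint_Sets" "HOL-Library.Extended_Nat"
begin

text \<open>
  The set of natural numbers of the source starts at 1, so it is the set \<open>{1..}\<close> here, and
  \<open>[n]\<close> is \<open>{1..n}\<close>.  Vectors indexed by \<open>{1..k}\<close>, matrices indexed by
  \<open>{1..k} \<times> {1..k}\<close> and maps on the space of partitions are extensional functions
  (\<open>undefined\<close> outside their domain), so that HOL equality is equality of the
  mathematical objects.
\<close>

definition kpartitions :: "nat set \<Rightarrow> nat \<Rightarrow> (nat \<Rightarrow> nat set) set" where
  "kpartitions A k =
     {lam \<in> {1..k} \<rightarrow>\<^sub>E Pow A. disjoint_family_on lam {1..k} \<and> (\<Union>i\<in>{1..k}. lam i) = A}"

definition restr :: "nat \<Rightarrow> nat \<Rightarrow> (nat \<Rightarrow> nat set) \<Rightarrow> (nat \<Rightarrow> nat set)" where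
  "restr k n lam = (\<lambda>i\<in>{1..k}. lam i \<inter> {1..n})"

text \<open>
  The set below always contains 0, because \<open>[0]\<close> is empty; its supremum is \<open>\<infinity>\<close>
  if it is unbounded and its maximum otherwise.
\<close>

definition agreement :: "nat \<Rightarrow> (nat \<Rightarrow> nat set) \<Rightarrow> (nat \<Rightarrow> nat set) \<Rightarrow> enat" where
  "agreement k lam lam' = Sup {enat n | n. restr k n lam = restr k n lam'}"

definition pdist :: "nat \<Rightarrow> (nat \<Rightarrow> nat set) \<Rightarrow> (nat \<Rightarrow> nat set) \<Rightarrow> real" where
  "pdist k lam lam' = (case agreement k lam lam' of enat n \<Rightarrow> 1 / 2 ^ n | \<infinity> \<Rightarrow> 0)"

definition Lip :: "nat \<Rightarrow> ((nat \<Rightarrow> nat set) \<Rightarrow> (nat \<Rightarrow> nat set)) set" where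
  "Lip k = {F \<in> kpartitions {1..} k \<rightarrow>\<^sub>E kpartitions {1..} k.
     \<forall>lam \<in> kpartitions {1..} k. \<forall>lam' \<in> kpartitions {1..} k.
       pdist k (F lam) (F lam') \<le> pdist k lam lam'}"

text \<open>
  The restriction of a map to \<open>[n]\<close> uses some extension of its argument; for a Lipschitz map
  the choice is irrelevant, see \<open>map_restr_eq\<close>.
\<close>

definition map_restr ::
    "nat \<Rightarrow> nat \<Rightarrow> ((nat \<Rightarrow> nat set) \<Rightarrow> (nat \<Rightarrow> nat set)) \<Rightarrow> (nat \<Rightarrow> nat set) \<Rightarrow> (nat \<Rightarrow> nat set)" where
  "map_restr k n F = (\<lambda>lam\<in>kpartitions {1..n} k.
     restr k n (F (SOME ext. ext \<in> kpartitions {1..} k \<and> restr k n ext = lam)))"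

definition overlap :: "nat \<Rightarrow> (nat \<Rightarrow> nat set) \<Rightarrow> (nat \<Rightarrow> nat set) \<Rightarrow> nat set" where
  "overlap k lam lam' = (\<Union>i\<in>{1..k}. lam i \<inter> lam' i)"

definition Sigma_level :: "nat \<Rightarrow> nat \<Rightarrow> ((nat \<Rightarrow> nat set) \<Rightarrow> (nat \<Rightarrow> nat set)) set" where
  "Sigma_level k n = {F \<in> Lip k.
     \<forall>lam \<in> kpartitions {1..n} k. \<forall>lam' \<in> kpartitions {1..n} k.
       overlap k lam lam' \<subseteq> overlap k (map_restr k n F lam) (map_restr k n F lam')}"

definition strongly_Lipschitz :: "nat \<Rightarrow> ((nat \<Rightarrow> nat set) \<Rightarrow> (nat \<Rightarrow> nat set)) set" where
  "strongly_Lipschitz k = (\<Inter>n\<in>{1..}. Sigma_level k n)"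

definition partition_operators :: "nat set \<Rightarrow> nat \<Rightarrow> (nat \<times> nat \<Rightarrow> nat set) set" where
  "partition_operators A k =
     {M \<in> {1..k} \<times> {1..k} \<rightarrow>\<^sub>E Pow A. \<forall>j\<in>{1..k}. (\<lambda>i\<in>{1..k}. M (i, j)) \<in> kpartitions A k}"

definition operator_action ::
    "nat \<Rightarrow> (nat \<times> nat \<Rightarrow> nat set) \<Rightarrow> (nat \<Rightarrow> nat set) \<Rightarrow> (nat \<Rightarrow> nat set)" where
  "operator_action k M lam = (\<lambda>i\<in>{1..k}. \<Union>j\<in>{1..k}. M (i, j) \<inter> lam j)"

definition operator_map ::
    "nat \<Rightarrow> (nat \<times> nat \<Rightarrow> nat set) \<Rightarrow> (nat \<Rightarrow> nat set) \<Rightarrow> (nat \<Rightarrow> nat set)" where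
  "operator_map k M = (\<lambda>lam\<in>kpartitions {1..} k. operator_action k M lam)"


lemma restr_eq_mono:
  assumes "restr k n lam = restr k n lam'" "m \<le> n"
  shows "restr k m lam = restr k m lam'"
proof -
  have "restr k m l = restr k m (restr k n l)" for l
    using assms(2) by (auto simp: restr_def restrict_def fun_eq_iff)
  then show ?thesis using assms(1) by metis
qed

lemma restr_eq_iff_agreement: "restr k n lam = restr k n lam' \<longleftrightarrow> enat n \<le> agreement k lam lam'"
proof
  assume "restr k n lam = restr k n lam'"
  then show "enat n \<le> agreement k lam lam'"
    unfolding agreement_def by (intro Sup_upper) auto
next
  assume le: "enat n \<le> agreement k lam lam'"
  show "restr k n lam = restr k n lam'"
  proof (cases n)
    case 0
    then show ?thesis by (auto simp: restr_def)
  next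
    case (Suc m)
    then have "enat m < agreement k lam lam'"
      using le by (metis Suc_ile_eq)
    then obtain p where "restr k p lam = restr k p lam'" "m < p"
      unfolding agreement_def less_Sup_iff by auto
    then show ?thesis using Suc restr_eq_mono by (metis Suc_leI)
  qed
qed

lemma pdist_le_iff:
  "pdist k a b \<le> pdist k c d \<longleftrightarrow> agreement k c d \<le> agreement k a b"
  by (auto simp: pdist_def divide_simps split: enat.splits)

lemma Lip_restr:
  assumes "F \<in> Lip k" "lam \<in> kpartitions {1..} k" "lam' \<in> kpartitions {1..} k"
    and "restr k n lam = restr k n lam'"
  shows "restr k n (F lam) = restr k n (F lam')"
  using assms unfolding Lip_def restr_eq_iff_agreement pdist_le_iff
  by (auto intro: order_trans)

lemma restr_kpartitions:
  assumes "lam \<in> kpartitions {1..} k"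
  shows "restr k n lam \<in> kpartitions {1..n} k"
proof -
  have un: "(\<Union>i\<in>{1..k}. lam i) = {1..}" and dis: "disjoint_family_on lam {1..k}"
    using assms by (auto simp: kpartitions_def)
  have "(\<Union>i\<in>{1..k}. restr k n lam i) = (\<Union>i\<in>{1..k}. lam i) \<inter> {1..n}"
    by (auto simp: restr_def)
  then have "(\<Union>i\<in>{1..k}. restr k n lam i) = {1..n}"
    unfolding un by auto
  moreover have "disjoint_family_on (restr k n lam) {1..k}"
    using dis by (simp add: restr_def disjoint_family_on_def) blast
  moreover have "restr k n lam \<in> {1..k} \<rightarrow>\<^sub>E Pow {1..n}"
    by (simp add: restr_def PiE_iff)
  ultimately show ?thesis by (simp add: kpartitions_def)
qed

lemma map_restr_eq:
  assumes F: "F \<in> Lip k" and ext: "ext \<in> kpartitions {1..} k" "restr k n ext = lam"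
  shows "map_restr k n F lam = restr k n (F ext)"
proof -
  let ?e = "SOME ext. ext \<in> kpartitions {1..} k \<and> restr k n ext = lam"
  have "?e \<in> kpartitions {1..} k \<and> restr k n ?e = lam"
    by (rule someI[where x = ext]) (use ext in simp)
  then show ?thesis
    using Lip_restr[OF F _ ext(1), of ?e n] ext restr_kpartitions[OF ext(1), of n]
    by (auto simp: map_restr_def)
qed

lemma restr_surj:
  assumes "k \<ge> 1" "lam \<in> kpartitions {1..n} k"
  shows "\<exists>ext \<in> kpartitions {1..} k. restr k n ext = lam"
proof
  let ?e = "\<lambda>i\<in>{1..k}. if i = 1 then lam i \<union> {n<..} else lam i"
  have sub: "lam i \<subseteq> {1..n}" if "i \<in> {1..k}" for i
    using assms(2) that by (auto simp: kpartitions_def)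
  have un: "(\<Union>i\<in>{1..k}. lam i) = {1..n}" and dis: "disjoint_family_on lam {1..k}"
    and ext: "lam \<in> extensional {1..k}"
    using assms(2) by (auto simp: kpartitions_def PiE_def)
  have "(\<Union>i\<in>{1..k}. ?e i) = (\<Union>i\<in>{1..k}. lam i) \<union> {n<..}"
    using assms(1) by auto
  then have "(\<Union>i\<in>{1..k}. ?e i) = {1..}" unfolding un by auto
  moreover have "disjoint_family_on ?e {1..k}"
    unfolding disjoint_family_on_def
  proof (intro ballI impI)
    fix i j assume ij: "i \<in> {1..k}" "j \<in> {1..k}" "i \<noteq> j"
    have "lam i \<inter> lam j = {}"
      using dis ij by (simp add: disjoint_family_on_def)
    then show "?e i \<inter> ?e j = {}"
      using ij sub[OF ij(1)] sub[OF ij(2)] by auto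
  qed
  moreover have "?e \<in> {1..k} \<rightarrow>\<^sub>E Pow {1..}"
  proof (rule restrict_PiE_iff[THEN iffD2], rule ballI)
    fix i assume "i \<in> {1..k}"
    then show "(if i = 1 then lam i \<union> {n<..} else lam i) \<in> Pow {1..}"
      using sub[of i] by auto
  qed
  ultimately show "?e \<in> kpartitions {1..} k" by (simp add: kpartitions_def)
  show "restr k n ?e = lam"
  proof
    fix i
    show "restr k n ?e i = lam i"
    proof (cases "i \<in> {1..k}")
      case True
      then show ?thesis using sub[OF True] by (auto simp: restr_def)
    next
      case False
      then show ?thesis using extensional_arb[OF ext False] by (simp only: restr_def restrict_apply if_False)
    qed
  qed
qed

lemma overlap_restr: "overlap k (restr k n lam) (restr k n lam') = overlap k lam lam' \<inter> {1..n}"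
  by (auto simp: overlap_def restr_def)

lemma overlap_subset:
  assumes "lam \<in> kpartitions A k"
  shows "overlap k lam lam' \<subseteq> A"
  using assms by (auto simp: overlap_def kpartitions_def)

lemma strongly_Lipschitz_iff:
  assumes k: "k \<ge> 1"
  shows "F \<in> strongly_Lipschitz k \<longleftrightarrow> F \<in> Lip k \<and>
    (\<forall>lam \<in> kpartitions {1..} k. \<forall>lam' \<in> kpartitions {1..} k.
       overlap k lam lam' \<subseteq> overlap k (F lam) (F lam'))" (is "?L \<longleftrightarrow> _ \<and> ?R")
proof -
  have "?L \<longleftrightarrow> ?R" if F: "F \<in> Lip k"
  proof
    assume L: ?L
    show ?R
    proof (intro ballI subsetI)
      fix lam lam' x
      assume l: "lam \<in> kpartitions {1..} k" "lam' \<in> kpartitions {1..} k"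
        and x: "x \<in> overlap k lam lam'"
      have x1: "x \<ge> 1" using overlap_subset[OF l(1)] x by auto
      then have "F \<in> Sigma_level k x" using L by (auto simp: strongly_Lipschitz_def)
      then have "overlap k (restr k x lam) (restr k x lam')
          \<subseteq> overlap k (restr k x (F lam)) (restr k x (F lam'))"
        using restr_kpartitions[OF l(1), of x] restr_kpartitions[OF l(2), of x]
          map_restr_eq[OF F l(1) refl, of x] map_restr_eq[OF F l(2) refl, of x]
          l by (metis (no_types, lifting) Sigma_level_def mem_Collect_eq)
      then show "x \<in> overlap k (F lam) (F lam')"
        using x x1 unfolding overlap_restr by auto
    qed
  next
    assume R: ?R
    have "F \<in> Sigma_level k n" for n
      unfolding Sigma_level_def
    proof (intro CollectI conjI F ballI)
      fix lam lam' assume "lam \<in> kpartitions {1..n} k" "lam' \<in> kpartitions {1..n} k"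
      then obtain e e' where e: "e \<in> kpartitions {1..} k" "restr k n e = lam"
        "e' \<in> kpartitions {1..} k" "restr k n e' = lam'"
        using restr_surj[OF k] by metis
      then show "overlap k lam lam' \<subseteq> overlap k (map_restr k n F lam) (map_restr k n F lam')"
        using R[rule_format, OF e(1,3)]
        unfolding map_restr_eq[OF F e(1,2)] map_restr_eq[OF F e(3,4)]
        unfolding e(2,4)[symmetric] overlap_restr by blast
    qed
    then show ?L by (simp add: strongly_Lipschitz_def)
  qed
  moreover have "F \<in> Lip k" if ?L
    using that by (auto simp: strongly_Lipschitz_def Sigma_level_def)
  ultimately show ?thesis by blast
qed

end

theory Submission imports Defs begin

text \<open>
  Let \<open>e\<^sub>j\<close> be the partition whose \<open>j\<close>-th block is everything.  An operator \<open>M\<close> sends \<open>e\<^sub>j\<close> to its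
  \<open>j\<close>-th column, so it is determined by its action.  Conversely, if \<open>F\<close> is strongly Lipschitz
  and \<open>x\<close> lies in block \<open>j\<close> of \<open>\<lambda>\<close>, then \<open>x\<close> lies in the overlap of \<open>\<lambda>\<close> and \<open>e\<^sub>j\<close>, hence in the
  same block of \<open>F \<lambda>\<close> and of \<open>F e\<^sub>j\<close>; so \<open>F\<close> is the action of the matrix with columns \<open>F e\<^sub>j\<close>.
\<close>

text \<open>Covering and disjointness together say that each point of \<open>A\<close> has exactly
  one block. This pointwise form suits the action of an operator, which is understood one point at a
  time.\<close>

lemma kpartitionsI:
  assumes ext: "lam \<in> {1..k} \<rightarrow>\<^sub>E Pow A"
    and ex1: "\<And>x. x \<in> A \<Longrightarrow> \<exists>!i. i \<in> {1..k} \<and> x \<in> lam i"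
  shows "lam \<in> kpartitions A k"
  unfolding kpartitions_def
proof (intro CollectI conjI ext equalityI)
  have sub: "lam i \<subseteq> A" if "i \<in> {1..k}" for i
    using PiE_mem[OF ext that] by (rule PowD)
  then show "(\<Union>i\<in>{1..k}. lam i) \<subseteq> A" by (rule UN_least)
  show "A \<subseteq> (\<Union>i\<in>{1..k}. lam i)"
  proof
    fix x assume "x \<in> A"
    then obtain i where "i \<in> {1..k}" "x \<in> lam i" using ex1 by metis
    then show "x \<in> (\<Union>i\<in>{1..k}. lam i)" by (rule UN_I)
  qed
  show "disjoint_family_on lam {1..k}"
    unfolding disjoint_family_on_def
  proof (intro ballI impI)
    fix i j assume "i \<in> {1..k}" "j \<in> {1..k}" "i \<noteq> j"
    then show "lam i \<inter> lam j = {}"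
      \<comment> \<open>Uniqueness is only assumed for points of \<open>A\<close>, so a common point
        of two blocks must first be placed in \<open>A\<close>.\<close>
      using ex1 sub[of i] by (metis disjoint_iff subsetD)
  qed
qed

lemma kpartitions_block_subset:
  assumes "lam \<in> kpartitions A k" "i \<in> {1..k}"
  shows "lam i \<subseteq> A"
  using assms by (auto simp: kpartitions_def PiE_iff)

lemma kpartitions_ex:
  assumes "lam \<in> kpartitions A k" "x \<in> A"
  obtains i where "i \<in> {1..k}" "x \<in> lam i"
proof -
  have "x \<in> (\<Union>i\<in>{1..k}. lam i)" using assms by (simp add: kpartitions_def)
  then show ?thesis using that by (rule UN_E)
qed

lemma kpartitions_unique:
  assumes "lam \<in> kpartitions A k" "i \<in> {1..k}" "j \<in> {1..k}" "x \<in> lam i" "x \<in> lam j"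
  shows "i = j"
proof (rule ccontr)
  assume "i \<noteq> j"
  then have "lam i \<inter> lam j = {}"
    using assms(1-3) by (simp add: kpartitions_def disjoint_family_on_def)
  then show False using assms(4,5) by blast
qed

lemma kpartitions_eqI:
  assumes "lam \<in> kpartitions A k" "lam' \<in> kpartitions A k"
    and "\<And>i. i \<in> {1..k} \<Longrightarrow> lam i = lam' i"
  shows "lam = lam'"
proof (rule PiE_ext)
  show "lam \<in> {1..k} \<rightarrow>\<^sub>E Pow A" "lam' \<in> {1..k} \<rightarrow>\<^sub>E Pow A"
    using assms(1,2) by (simp_all add: kpartitions_def)
qed (rule assms(3))

text \<open>The counterpart of the \<open>j\<close>-th standard basis vector: applying an operator
  to it extracts the \<open>j\<close>-th column.\<close>

definition single_block :: "nat set \<Rightarrow> nat \<Rightarrow> nat \<Rightarrow> (nat \<Rightarrow> nat set)" where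
  "single_block A k j = (\<lambda>i\<in>{1..k}. if i = j then A else {})"

lemma single_block_kpartitions:
  assumes "j \<in> {1..k}"
  shows "single_block A k j \<in> kpartitions A k"
proof (rule kpartitionsI)
  show "single_block A k j \<in> {1..k} \<rightarrow>\<^sub>E Pow A"
    by (auto simp: single_block_def)
  show "\<exists>!i. i \<in> {1..k} \<and> x \<in> single_block A k j i" if "x \<in> A" for x
    by (rule ex1I[of _ j]) (use assms that in \<open>auto simp: single_block_def split: if_splits\<close>)
qed

lemma partition_operator_column:
  assumes "M \<in> partition_operators A k" "j \<in> {1..k}"
  shows "(\<lambda>i\<in>{1..k}. M (i, j)) \<in> kpartitions A k"
  using assms by (simp add: partition_operators_def)

lemma partition_operator_entry_subset:
  assumes "M \<in> partition_operators A k" "i \<in> {1..k}" "j \<in> {1..k}"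
  shows "M (i, j) \<subseteq> A"
  using kpartitions_block_subset[OF partition_operator_column[OF assms(1,3)] assms(2)] assms(2)
  by simp

text \<open>The blocks of \<open>lam\<close> are disjoint, so only the \<open>j\<close>-th term of
  the union can contain \<open>x\<close>. Thus the action places \<open>x\<close> by looking it up
  in column \<open>j\<close>.\<close>

lemma mem_operator_action_iff:
  assumes "lam \<in> kpartitions A k" "j \<in> {1..k}" "x \<in> lam j" "i \<in> {1..k}"
  shows "x \<in> operator_action k M lam i \<longleftrightarrow> x \<in> M (i, j)"
proof -
  have "x \<in> operator_action k M lam i \<longleftrightarrow> (\<exists>j'\<in>{1..k}. x \<in> M (i, j') \<and> x \<in> lam j')"
    using assms(4) by (simp add: operator_action_def)
  then show ?thesis using kpartitions_unique[OF assms(1,2) _ assms(3)] assms(2,3) by blast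
qed

lemma operator_action_single_block:
  assumes "M \<in> partition_operators A k" "i \<in> {1..k}" "j \<in> {1..k}"
  shows "operator_action k M (single_block A k j) i = M (i, j)"
  using assms(2,3) partition_operator_entry_subset[OF assms]
  by (auto simp: operator_action_def single_block_def split: if_splits)

text \<open>At a point of block \<open>j\<close> of \<open>lam\<close> the action agrees with column
  \<open>j\<close> of \<open>M\<close>. That column is a partition, so the point inherits its unique
  block from there.\<close>

lemma operator_action_kpartitions:
  assumes M: "M \<in> partition_operators A k" and lam: "lam \<in> kpartitions A k"
  shows "operator_action k M lam \<in> kpartitions A k"
proof (rule kpartitionsI)
  show "operator_action k M lam \<in> {1..k} \<rightarrow>\<^sub>E Pow A"
    unfolding operator_action_def restrict_PiE_iff
    using kpartitions_block_subset[OF lam] by blast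
next
  fix x assume x: "x \<in> A"
  then obtain j where j: "j \<in> {1..k}" "x \<in> lam j"
    by (rule kpartitions_ex[OF lam])
  let ?col = "\<lambda>i\<in>{1..k}. M (i, j)"
  note col = partition_operator_column[OF M j(1)]
  have mem: "x \<in> operator_action k M lam i \<longleftrightarrow> x \<in> ?col i" if "i \<in> {1..k}" for i
    using mem_operator_action_iff[OF lam j that] that by simp
  obtain i where i: "i \<in> {1..k}" "x \<in> ?col i"
    using x by (rule kpartitions_ex[OF col])
  show "\<exists>!i. i \<in> {1..k} \<and> x \<in> operator_action k M lam i"
  proof (rule ex1I[of _ i])
    show "i \<in> {1..k} \<and> x \<in> operator_action k M lam i"
      using i mem[OF i(1)] by blast
    fix i' assume "i' \<in> {1..k} \<and> x \<in> operator_action k M lam i'"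
    then show "i' = i"
      using kpartitions_unique[OF col _ i(1) _ i(2)] mem by blast
  qed
qed

text \<open>Intersecting with \<open>{1..n}\<close> distributes over the union, so the truncated
  image depends only on the truncated blocks of the argument.\<close>

lemma restr_operator_action:
  assumes "restr k n lam = restr k n lam'"
  shows "restr k n (operator_action k M lam) = restr k n (operator_action k M lam')"
proof -
  have eq: "lam j \<inter> {1..n} = lam' j \<inter> {1..n}" if "j \<in> {1..k}" for j
    using fun_cong[OF assms, of j] that by (simp add: restr_def)
  have "(\<Union>j\<in>{1..k}. M (i, j) \<inter> lam j) \<inter> {1..n} = (\<Union>j\<in>{1..k}. M (i, j) \<inter> lam' j) \<inter> {1..n}" for i
    using eq by blast
  then show ?thesis
    by (simp add: restr_def operator_action_def cong: restrict_cong)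
qed

text \<open>Distances are compared through \<open>agreement\<close>, so it suffices that equality of
  restrictions is preserved for every \<open>n\<close>; this is the converse of
  \<open>Lip_restr\<close>.\<close>

lemma LipI:
  assumes F: "F \<in> kpartitions {1..} k \<rightarrow>\<^sub>E kpartitions {1..} k"
    and restr: "\<And>lam lam' n. lam \<in> kpartitions {1..} k \<Longrightarrow> lam' \<in> kpartitions {1..} k \<Longrightarrow>
      restr k n lam = restr k n lam' \<Longrightarrow> restr k n (F lam) = restr k n (F lam')"
  shows "F \<in> Lip k"
  unfolding Lip_def pdist_le_iff
proof (intro CollectI conjI F ballI)
  fix lam lam' assume l: "lam \<in> kpartitions {1..} k" "lam' \<in> kpartitions {1..} k"
  show "agreement k lam lam' \<le> agreement k (F lam) (F lam')"
    \<comment> \<open>Only the agreement of the arguments is opened as a supremum; that of the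
      images stays folded for \<open>restr_eq_iff_agreement\<close>.\<close>
    unfolding agreement_def[of k lam]
    by (rule Sup_least) (use restr[OF l] in \<open>auto simp flip: restr_eq_iff_agreement\<close>)
qed

text \<open>A point lying in block \<open>j\<close> of both arguments is looked up in the same
  column \<open>j\<close> for both images, so it lands in the same block of each.\<close>

lemma operator_map_strongly_Lipschitz:
  assumes k: "k \<ge> 1" and M: "M \<in> partition_operators {1..} k"
  shows "operator_map k M \<in> strongly_Lipschitz k"
  unfolding strongly_Lipschitz_iff[OF k]
proof (intro conjI ballI subsetI)
  have map_eq: "operator_map k M lam = operator_action k M lam" if "lam \<in> kpartitions {1..} k" for lam
    using that by (simp only: operator_map_def restrict_apply')
  show "operator_map k M \<in> Lip k"
  proof (rule LipI)
    show "operator_map k M \<in> kpartitions {1..} k \<rightarrow>\<^sub>E kpartitions {1..} k"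
      using operator_action_kpartitions[OF M] by (simp add: operator_map_def)
  qed (simp only: map_eq, rule restr_operator_action)
  fix lam lam' x
  assume l: "lam \<in> kpartitions {1..} k" "lam' \<in> kpartitions {1..} k"
    and "x \<in> overlap k lam lam'"
  then obtain j where j: "j \<in> {1..k}" "x \<in> lam j" "x \<in> lam' j"
    unfolding overlap_def by blast
  have "x \<in> {1..}" using kpartitions_block_subset[OF l(1) j(1)] j(2) by blast
  then obtain i where i: "i \<in> {1..k}" "x \<in> operator_action k M lam i"
    by (rule kpartitions_ex[OF operator_action_kpartitions[OF M l(1)]])
  then have "x \<in> operator_action k M lam' i"
    using mem_operator_action_iff[OF l(1) j(1,2) i(1)] mem_operator_action_iff[OF l(2) j(1,3) i(1)]
    by simp
  then show "x \<in> overlap k (operator_map k M lam) (operator_map k M lam')"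
    unfolding overlap_def map_eq[OF l(1)] map_eq[OF l(2)] using i by blast
qed

lemma inj_on_operator_map: "inj_on (operator_map k) (partition_operators {1..} k)"
proof (rule inj_onI)
  fix M N assume MN: "M \<in> partition_operators {1..} k" "N \<in> partition_operators {1..} k"
    and eq: "operator_map k M = operator_map k N"
  show "M = N"
  proof (rule PiE_ext)
    show "M \<in> {1..k} \<times> {1..k} \<rightarrow>\<^sub>E Pow {1..}" "N \<in> {1..k} \<times> {1..k} \<rightarrow>\<^sub>E Pow {1..}"
      using MN by (simp_all add: partition_operators_def)
    fix p assume p: "p \<in> {1..k} \<times> {1..k}"
    obtain i j where ij: "p = (i, j)" "i \<in> {1..k}" "j \<in> {1..k}"
      using p by blast
    let ?e = "single_block {1..} k j"
    have "operator_action k M ?e = operator_action k N ?e"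
      using fun_cong[OF eq, of ?e] single_block_kpartitions[OF ij(3), of "{1..}"]
      by (simp add: operator_map_def)
    then show "M p = N p"
      using operator_action_single_block[OF MN(1) ij(2,3)]
        operator_action_single_block[OF MN(2) ij(2,3)] ij(1) by simp
  qed
qed

lemma strongly_Lipschitz_eq_operator_map:
  assumes k: "k \<ge> 1" and F: "F \<in> strongly_Lipschitz k"
  obtains M where "M \<in> partition_operators {1..} k" "operator_map k M = F"
proof
  let ?e = "single_block {1..} k"
  define M where "M = (\<lambda>(i, j)\<in>{1..k} \<times> {1..k}. F (?e j) i)"
  have Fext: "F \<in> kpartitions {1..} k \<rightarrow>\<^sub>E kpartitions {1..} k"
    and Fov: "\<And>lam lam'. lam \<in> kpartitions {1..} k \<Longrightarrow> lam' \<in> kpartitions {1..} k \<Longrightarrow>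
      overlap k lam lam' \<subseteq> overlap k (F lam) (F lam')"
    using F unfolding strongly_Lipschitz_iff[OF k] Lip_def by blast+
  note Fp = PiE_mem[OF Fext]
  have Fe: "F (?e j) \<in> kpartitions {1..} k" if "j \<in> {1..k}" for j
    by (rule Fp[OF single_block_kpartitions[OF that]])
  have M_eq: "M (i, j) = F (?e j) i" if "i \<in> {1..k}" "j \<in> {1..k}" for i j
    using that by (simp add: M_def)
  have col: "(\<lambda>i\<in>{1..k}. M (i, j)) = F (?e j)" if "j \<in> {1..k}" for j
  \<comment> \<open>The equality must also hold outside \<open>{1..k}\<close>, where both sides are
    \<open>undefined\<close> because \<open>F (?e j)\<close> is extensional.\<close>
  proof
    fix i
    have "F (?e j) \<in> extensional {1..k}"
      using Fe[OF that] by (simp add: kpartitions_def PiE_def)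
    then show "(\<lambda>i\<in>{1..k}. M (i, j)) i = F (?e j) i"
      using M_eq[of i j] that by (auto simp: restrict_def extensional_def)
  qed
  show M: "M \<in> partition_operators {1..} k"
    unfolding partition_operators_def
  proof (intro CollectI conjI ballI)
    have "F (?e j) i \<in> Pow {1..}" if "i \<in> {1..k}" "j \<in> {1..k}" for i j
      using kpartitions_block_subset[OF Fe[OF that(2)] that(1)] by blast
    then show "M \<in> {1..k} \<times> {1..k} \<rightarrow>\<^sub>E Pow {1..}"
      unfolding M_def restrict_PiE_iff by blast
  qed (use col Fe in simp)
  show "operator_map k M = F"
  proof (rule PiE_ext[OF _ Fext])
    show "operator_map k M \<in> kpartitions {1..} k \<rightarrow>\<^sub>E kpartitions {1..} k"
      using operator_action_kpartitions[OF M] by (simp add: operator_map_def)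
  next
    fix lam assume lam: "lam \<in> kpartitions {1..} k"
    have iff: "x \<in> operator_action k M lam i \<longleftrightarrow> x \<in> F lam i"
      if i: "i \<in> {1..k}" and x: "x \<in> {1..}" for i x
    proof -
      obtain j where j: "j \<in> {1..k}" "x \<in> lam j"
        using x by (rule kpartitions_ex[OF lam])
      have "x \<in> overlap k lam (?e j)"
        using j x by (auto simp: overlap_def single_block_def)
      then obtain l where l: "l \<in> {1..k}" "x \<in> F lam l" "x \<in> F (?e j) l"
        using Fov[OF lam single_block_kpartitions[OF j(1)]] by (auto simp: overlap_def)
      \<comment> \<open>Block \<open>l\<close> contains \<open>x\<close> in both images and their
        blocks are disjoint, so both memberships reduce to \<open>i = l\<close> and hence
        agree.\<close>
      have "x \<in> F lam i \<longleftrightarrow> i = l" "x \<in> F (?e j) i \<longleftrightarrow> i = l"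
        using kpartitions_unique[OF Fp[OF lam] i l(1)] kpartitions_unique[OF Fe[OF j(1)] i l(1)] l
        by blast+
      then show ?thesis
        using mem_operator_action_iff[OF lam j i] M_eq[OF i j(1)] by simp
    qed
    have "operator_action k M lam = F lam"
    proof (rule kpartitions_eqI[OF operator_action_kpartitions[OF M lam] Fp[OF lam]])
      fix i assume i: "i \<in> {1..k}"
      show "operator_action k M lam i = F lam i"
        \<comment> \<open>Here \<open>iff\<close> covers positive points only; both blocks are
          subsets of \<open>{1..}\<close>, which excludes \<open>0\<close> from each.\<close>
        using iff[OF i] kpartitions_block_subset[OF Fp[OF lam] i]
          kpartitions_block_subset[OF operator_action_kpartitions[OF M lam] i] by blast
    qed
    then show "operator_map k M lam = F lam"
      using lam by (simp add: operator_map_def)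
  qed
qed

theorem proposition4p2:
  fixes k :: nat
  assumes "k \<ge> 1"
  shows "bij_betw (operator_map k) (partition_operators {1..} k) (strongly_Lipschitz k)"
proof (intro bij_betw_imageI inj_on_operator_map equalityI subsetI)
  fix F assume "F \<in> operator_map k ` partition_operators {1..} k"
  then show "F \<in> strongly_Lipschitz k"
    using operator_map_strongly_Lipschitz[OF assms] by blast
next
  fix F assume "F \<in> strongly_Lipschitz k"
  then obtain M where "M \<in> partition_operators {1..} k" "operator_map k M = F"
    by (rule strongly_Lipschitz_eq_operator_map[OF assms])
  then show "F \<in> operator_map k ` partition_operators {1..} k" by blast
qed

end
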